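(* Consider the subgradient-push algorithm (described in the context). Suppose that $\{\mathbb G(t)\}_{t\ge0}$ is uniformly strongly connected by sub-sequences of length $L$ and that $\|g_i(t)\|_2$ is uniformly bounded above by a positive number $G$ for all $i$ and $t$. Let $z^*$ be a minimizer of $f$. 1) If the stepsize $\alpha(t)$ is time-varying and $\{\alpha(t)\}$ is positive, non-increasing, and satisfies $\sum_{t=0}^\infty\alpha(t)=\infty$ and $\sum_{t=0}^\infty\alpha^2(t)<\infty$, then for all $t\ge0$ and $k\in\mathcal V$, $$\begin{aligned}f\left(\frac{\sum_{\tau=0}^t\alpha(\tau)z_k(\tau)}{\sum_{\tau=0}^t\alpha(\tau)}\right)-f(z^* )\le{}&\frac{\|\bar z(0)-z^*\|_2^2+G^2\sum_{\tau=0}^t\alpha^2(\tau)}{\sum_{\tau=0}^t2\alpha(\tau)}\\&+\frac{G\alpha(0)\sum_{i=1}^n\big(\|\bar z(0)-z_i(0)\|_2+\|z_k(0)-z_i(0)\|_2\big)}{n\sum_{\tau=0}^t\alpha(\tau)}\\&+\frac{32G}{\eta}\sum_{i=1}^n\big\|x_i(0)-\alpha(0)g_i(0)\big\|_2\,\frac{\sum_{\tau=0}^{t-1}\alpha(\tau)\mu^\tau}{\sum_{\tau=0}^t\alpha(\tau)}\\&+\frac{32nG^2}{\eta(1-\mu)}\,\frac{\sum_{\tau=0}^{t-1}\alpha(\tau)\left(\alpha(0)\mu^{\tau/2}+\alpha(\lceil\frac\tau2\rceil)\right)}{\sum_{\tau=0}^t\alpha(\tau)}.\end{aligned}$$ 2)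 If the stepsize is fixed and $\alpha(t)=1/\sqrt T$ for $T>0$ steps, i.e. $t\in\{0,1,\dots,T-1\}$, then for any $k\in\mathcal V$, $$\begin{aligned}f\left(\frac{\sum_{\tau=0}^{T-1}z_k(\tau)}{T}\right)-f(z^* )\le{}&\frac{\|\bar z(0)-z^*\|_2^2+G^2}{2\sqrt T}+\frac{32nG^2}{\eta(1-\mu)\sqrt T}\\&+\frac{G\sum_{i=1}^n\big(\|\bar z(0)-z_i(0)\|_2+\|z_k(0)-z_i(0)\|_2\big)}{nT}\\&+\frac{32G}{\eta(1-\mu)T}\sum_{i=1}^n\Big\|x_i(0)-\frac1{\sqrt T}g_i(0)\Big\|_2.\end{aligned}$$ Here $\eta$ and $\mu<1$ are positive constants (the ones described in the context) which satisfy $\eta\ge\frac1{n^{nL}}$ and $\mu\le\left(1-\frac1{n^{nL}}\right)^{1/L}$, respectively, and $\lceil\cdot\rceil$ denotes the ceiling function.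
   Context: Network and weights. There are $n$ agents, $\mathcal V=\{1,\dots,n\}$. For each integer $t\ge0$, $\mathbb G(t)=(\mathcal V,\mathcal E(t))$ is a directed graph with self-arcs at all vertices. $\mathcal N_i(t)=\{j:(j,i)\in\mathcal E(t)\}$ and $\mathcal N_i^-(t)=\{k:(i,k)\in\mathcal E(t)\}$ are the in- and out-neighbor sets of $i$ (both contain $i$). The weights satisfy: there is a constant $\beta>0$ such that $w_{ij}(t)\ge\beta$ for all $i,t$ and $j\in\mathcal N_i(t)$; $w_{ij}(t)=0$ if $j\notin\mathcal N_i(t)$; and $\sum_{j\in\mathcal N_i^-(t)}w_{ji}(t)=1$ for all $i,t$. $W(t)$ is the $n\times n$ (column stochastic) matrix with entries $w_{ij}(t)$. Uniform strong connectivity. $\{\mathbb G(t)\}$ is uniformly strongly connected by sub-sequences of length $L$ ($L$ a positive integer) if for every $t\ge0$ the union graph $\cup_{k=t}^{t+L-1}\mathbb G(k)$ (vertex set $\mathcal V$, union of the edge sets) is strongly connected. Problem. Each $f_i:\mathbb R^d\to\mathbb R$ is convex (not necessarily differentiable), $f(z)=\frac1n\sum_{i=1}^n f_i(z)$, and the set of minimizers of $f$ is assumed nonempty. A subgradient of a convex $h:\mathbb R^d\to\mathbb R$ at $x$ is a vector $g$ with $h(y)\ge h(x)+g^\top(y-x)$ for all $y\in\mathbb R^d$. Subgradient-push algorithm. With $x_i(0)\in\mathbb R^d$ and $y_i(0)=1$, $$x_i(t+1)=\sum_{j\in\mathcal N_i(t)}w_{ij}(t)\big[x_j(t)-\alpha(t)g_j(t)\big],\qquad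 y_i(t+1)=\sum_{j\in\mathcal N_i(t)}w_{ij}(t)y_j(t),$$ where $\alpha(t)$ is the stepsize and $g_j(t)$ is a subgradient of $f_j$ at $x_j(t)/y_j(t)$. Define $z_i(t)=x_i(t)/y_i(t)$ and $\bar z(t)=\frac1n\sum_{i=1}^n z_i(t)$. Constants. $\eta>0$ is a constant with $n\ge y_i(t)\ge\eta$ for all $i$ and $t$. $\mu<1$ is a constant for which there is a sequence of stochastic vectors $\{v(t)\}$ in $\mathbb R^n$ (nonnegative entries summing to one) with $\big|[W(t)\cdots W(\tau+1)W(\tau)]_{ij}-v_i(t)\big|\le4\mu^{t-\tau}$ for all $i,j\in\mathcal V$ and $t\ge\tau\ge0$, where $[\cdot]_{ij}$ denotes the $ij$th entry of a matrix. Empty sums are $0$.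
   Formalization: Beyond ‖g_i(t)‖≤G it is assumed that each f_i has some subgradient of norm ≤G at every z_k(t) (the claim fails without this; it follows if all subgradients of the f_i are bounded by G); the bounds on η and μ are taken as conditions on these constants. *)

theory Defs
  imports
    "HOL-Analysis.Analysis"
    "Graph_Theory.Pair_Digraph"
    "Graph_Theory.Digraph_Component"
begin

text \<open>
  The agents are the elements of a finite type \<open>'n\<close>, so \<open>n = CARD('n)\<close>. A digraph on all agents is
  given by its arc set; an arc \<open>(j, i)\<close> means that \<open>i\<close> receives information from \<open>j\<close>.
\<close>

definition in_nbrs :: "('n \<times> 'n) set \<Rightarrow> 'n \<Rightarrow> 'n set" where
  "in_nbrs A i = {j. (j, i) \<in> A}"

definition out_nbrs :: "('n \<times> 'n) set \<Rightarrow> 'n \<Rightarrow> 'n set" where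
  "out_nbrs A i = {k. (i, k) \<in> A}"

definition uniformly_strongly_connected :: "(nat \<Rightarrow> ('n \<times> 'n) set) \<Rightarrow> nat \<Rightarrow> bool" where
  "uniformly_strongly_connected E L \<longleftrightarrow>
     (\<forall>t. strongly_connected (with_proj \<lparr>pverts = UNIV, parcs = (\<Union>k\<in>{t..<t + L}. E k)\<rparr>))"

definition push_weights ::
    "(nat \<Rightarrow> ('n::finite \<times> 'n) set) \<Rightarrow> real \<Rightarrow> (nat \<Rightarrow> real^'n^'n) \<Rightarrow> bool" where
  "push_weights E \<beta> W \<longleftrightarrow>
     (\<forall>t i j. j \<in> in_nbrs (E t) i \<longrightarrow> W t $ i $ j \<ge> \<beta>) \<and>
     (\<forall>t i j. j \<notin> in_nbrs (E t) i \<longrightarrow> W t $ i $ j = 0) \<and>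
     (\<forall>t i. (\<Sum>j\<in>out_nbrs (E t) i. W t $ j $ i) = 1)"

text \<open>For \<open>\<tau> \<le> t\<close> this is \<open>W t ** \<dots> ** W (\<tau> + 1) ** W \<tau>\<close>, later factors on the left.\<close>

definition backward_prod :: "(nat \<Rightarrow> real^'n^'n) \<Rightarrow> nat \<Rightarrow> nat \<Rightarrow> real^'n^'n" where
  "backward_prod W \<tau> t = fold (\<lambda>k M. W k ** M) [\<tau>..<Suc t] (mat 1)"

definition stochastic_vec :: "real^'n::finite \<Rightarrow> bool" where
  "stochastic_vec v \<longleftrightarrow> (\<forall>i. 0 \<le> v $ i) \<and> (\<Sum>i\<in>UNIV. v $ i) = 1"

definition mixing_rate :: "(nat \<Rightarrow> real^'n^'n) \<Rightarrow> real \<Rightarrow> bool" where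
  "mixing_rate W \<mu> \<longleftrightarrow>
     (\<exists>v. (\<forall>t. stochastic_vec (v t)) \<and>
          (\<forall>t \<tau> i j. \<tau> \<le> t \<longrightarrow> \<bar>backward_prod W \<tau> t $ i $ j - v t $ i\<bar> \<le> 4 * \<mu> ^ (t - \<tau>)))"

definition is_subgradient :: "('a::real_inner \<Rightarrow> real) \<Rightarrow> 'a \<Rightarrow> 'a \<Rightarrow> bool" where
  "is_subgradient h x g \<longleftrightarrow> (\<forall>y. h y \<ge> h x + g \<bullet> (y - x))"

definition avg_fun :: "('n::finite \<Rightarrow> 'a \<Rightarrow> real) \<Rightarrow> 'a \<Rightarrow> real" where
  "avg_fun f z = (\<Sum>i\<in>UNIV. f i z) / real CARD('n)"

definition avg_vec :: "('n::finite \<Rightarrow> 'a::real_vector) \<Rightarrow> 'a" where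
  "avg_vec u = (\<Sum>i\<in>UNIV. u i) /\<^sub>R real CARD('n)"

primrec push_y ::
    "(nat \<Rightarrow> ('n::finite \<times> 'n) set) \<Rightarrow> (nat \<Rightarrow> real^'n^'n) \<Rightarrow> nat \<Rightarrow> 'n \<Rightarrow> real" where
  "push_y E W 0 i = 1"
| "push_y E W (Suc t) i = (\<Sum>j\<in>in_nbrs (E t) i. W t $ i $ j * push_y E W t j)"

text \<open>
  \<open>H\<close> is the set of times at which a step is performed: all of them for an infinite run, and
  \<open>{..<T}\<close> for a run of \<open>T\<close> steps.
\<close>

definition subgradient_push ::
    "(nat \<Rightarrow> ('n::finite \<times> 'n) set) \<Rightarrow> (nat \<Rightarrow> real^'n^'n) \<Rightarrow> ('n \<Rightarrow> 'a::real_inner \<Rightarrow> real) \<Rightarrow>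
     (nat \<Rightarrow> real) \<Rightarrow> nat set \<Rightarrow>
     (nat \<Rightarrow> 'n \<Rightarrow> 'a) \<Rightarrow> (nat \<Rightarrow> 'n \<Rightarrow> 'a) \<Rightarrow> (nat \<Rightarrow> 'n \<Rightarrow> 'a) \<Rightarrow> bool" where
  "subgradient_push E W f \<alpha> H x z g \<longleftrightarrow>
     (\<forall>t i. z t i = x t i /\<^sub>R push_y E W t i) \<and>
     (\<forall>t\<in>H. \<forall>i. is_subgradient (f i) (z t i) (g t i)) \<and>
     (\<forall>t\<in>H. \<forall>i. x (Suc t) i = (\<Sum>j\<in>in_nbrs (E t) i. W t $ i $ j *\<^sub>R (x t j - \<alpha> t *\<^sub>R g t j)))"

text \<open>
  A bound on the \<open>g t i\<close> alone says nothing about \<open>f i\<close> at the iterates \<open>z t k\<close> of the other agents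
  \<open>k \<noteq> i\<close>, where \<open>f i\<close> may be arbitrarily steep, and then the error estimates for the iterates of a
  single agent \<open>k\<close> fail. The second conjunct extends the bound to these points; it holds in
  particular whenever all subgradients of all \<open>f i\<close> are bounded by \<open>G\<close>.
\<close>

definition subgradients_bounded ::
    "('n \<Rightarrow> 'a::real_inner \<Rightarrow> real) \<Rightarrow> nat set \<Rightarrow>
     (nat \<Rightarrow> 'n \<Rightarrow> 'a) \<Rightarrow> (nat \<Rightarrow> 'n \<Rightarrow> 'a) \<Rightarrow> real \<Rightarrow> bool" where
  "subgradients_bounded f H z g G \<longleftrightarrow>
     (\<forall>t\<in>H. \<forall>i. norm (g t i) \<le> G) \<and>
     (\<forall>t\<in>H. \<forall>i k. \<exists>s. is_subgradient (f i) (z t k) s \<and> norm s \<le> G)"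

end

theory Submission
  imports Defs
begin

text \<open>
  The matrices \<open>W t\<close> are column stochastic, so pushing preserves the sum over the agents, and the
  network average of the \<open>x\<^sub>i\<close> performs an ordinary subgradient step with the averaged
  subgradients. Up to errors, the classical argument therefore applies to it: the squared distance
  to the minimizer \<open>zs\<close> drops by \<open>2 \<alpha> (f - f zs)\<close> in each step, apart from \<open>\<alpha>\<^sup>2 G\<^sup>2\<close>
  (\<open>averaged_subgradient_step\<close>). The sum telescopes, and Jensen's inequality moves the weighted mean
  inside \<open>f\<close>.

  The errors arise because the subgradients are taken at the ratios \<open>z\<^sub>i = x\<^sub>i / y\<^sub>i\<close>, while \<open>f\<close> is to
  be estimated at a single \<open>z\<^sub>k\<close>. As all functions have subgradients of norm at most \<open>G\<close> at the
  points in question, they cost \<open>G\<close> times the distances of the \<open>z\<^sub>i\<close> from the average and from \<open>z\<^sub>k\<close>.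

  These distances are small because the products of the weight matrices forget their column index:
  every entry in row \<open>i\<close> of \<open>W t ** \<dots> ** W s\<close> is within \<open>8 \<mu>\<^bsup>t - s\<^esup>\<close> of \<open>y\<^sub>i (t + 1) / n\<close>
  (\<open>backward_prod_near_push_y\<close>). An input of size \<open>u\<close> at time \<open>s\<close> thus leaves, at time \<open>t + 1\<close>, the
  same contribution in all ratios up to \<open>8 \<mu>\<^bsup>t - s\<^esup> u / \<eta>\<close>; the initial state and every
  subgradient step are such inputs (\<open>subgradient_push_deviation\<close>). What remains is to bound the
  convolution of \<open>\<mu>\<^sup>s\<close> with the stepsizes, by splitting it in the middle for decreasing
  stepsizes (\<open>geometric_convolution_le\<close>) and by a geometric series for a fixed one.

  At time \<open>0\<close> the distances enter the bound as they are, and at time \<open>\<tau> + 1\<close> the estimates leave the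
  weight \<open>\<alpha> (\<tau> + 1)\<close>, which monotonicity replaces by \<open>\<alpha> \<tau>\<close>. Distances to the average carry
  the constant \<open>8\<close> and distances between two agents \<open>16\<close>; their sum \<open>24\<close> is below \<open>32\<close>.
\<close>

section \<open>Products of the weight matrices\<close>

lemma push_weights_sum_in_nbrs:
  fixes u :: "'n::finite \<Rightarrow> 'a::real_vector"
  assumes "push_weights E \<beta> W"
  shows "(\<Sum>j\<in>in_nbrs (E t) i. W t $ i $ j *\<^sub>R u j) = (\<Sum>j\<in>UNIV. W t $ i $ j *\<^sub>R u j)"
  by (rule sum.mono_neutral_left) (use assms in \<open>auto simp: push_weights_def\<close>)

lemma push_weights_column_sum:
  assumes "push_weights E \<beta> W"
  shows "(\<Sum>i\<in>UNIV. W t $ i $ j) = 1"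
proof -
  have "(\<Sum>i\<in>UNIV. W t $ i $ j) = (\<Sum>i\<in>out_nbrs (E t) j. W t $ i $ j)"
    by (rule sum.mono_neutral_right)
      (use assms in \<open>auto simp: push_weights_def in_nbrs_def out_nbrs_def\<close>)
  then show ?thesis using assms by (simp add: push_weights_def)
qed

lemma backward_prod_same: "backward_prod W t t = W t"
  by (simp add: backward_prod_def matrix_mul_rid)

lemma backward_prod_Suc:
  "s \<le> t \<Longrightarrow> backward_prod W s (Suc t) = W (Suc t) ** backward_prod W s t"
  by (simp add: backward_prod_def)

lemma sum_column_matrix_mult:
  fixes A B :: "real^'n^'n"
  assumes "\<And>j. (\<Sum>i\<in>UNIV. A $ i $ j) = 1"
  shows "(\<Sum>i\<in>UNIV. (A ** B) $ i $ j) = (\<Sum>i\<in>UNIV. B $ i $ j)"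
proof -
  have "(\<Sum>i\<in>UNIV. (A ** B) $ i $ j) = (\<Sum>k\<in>UNIV. \<Sum>i\<in>UNIV. A $ i $ k * B $ k $ j)"
    unfolding matrix_matrix_mult_def vec_lambda_beta by (rule sum.swap)
  also have "\<dots> = (\<Sum>k\<in>UNIV. (\<Sum>i\<in>UNIV. A $ i $ k) * B $ k $ j)"
    by (simp add: sum_distrib_right)
  finally show ?thesis by (simp add: assms)
qed

lemma backward_prod_column_sum:
  assumes "\<And>t j. (\<Sum>i\<in>UNIV. W t $ i $ j) = 1" and "s \<le> t"
  shows "(\<Sum>i\<in>UNIV. backward_prod W s t $ i $ j) = 1"
  using assms(2)
  by (induction t rule: dec_induct)
    (simp_all add: backward_prod_same backward_prod_Suc sum_column_matrix_mult assms(1))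

lemma sum_matrix_mult_scaleR:
  fixes A B :: "real^'n^'n" and u :: "'n \<Rightarrow> 'a::real_vector"
  shows "(\<Sum>j\<in>UNIV. (A ** B) $ i $ j *\<^sub>R u j) =
    (\<Sum>k\<in>UNIV. A $ i $ k *\<^sub>R (\<Sum>j\<in>UNIV. B $ k $ j *\<^sub>R u j))"
proof -
  have "(\<Sum>j\<in>UNIV. (A ** B) $ i $ j *\<^sub>R u j) =
      (\<Sum>j\<in>UNIV. \<Sum>k\<in>UNIV. A $ i $ k *\<^sub>R B $ k $ j *\<^sub>R u j)"
    by (simp add: matrix_matrix_mult_def scaleR_sum_left)
  also have "\<dots> = (\<Sum>k\<in>UNIV. \<Sum>j\<in>UNIV. A $ i $ k *\<^sub>R B $ k $ j *\<^sub>R u j)"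
    by (rule sum.swap)
  finally show ?thesis by (simp add: scaleR_sum_right)
qed

section \<open>Unrolling the recursions\<close>

text \<open>
  Discrete variation of constants: an input injected at time \<open>s\<close> reaches the state at time
  \<open>t + 1\<close> through \<open>W t ** \<dots> ** W s\<close>. The initial state is counted as part of the input \<open>p 0\<close>, so
  that no separate homogeneous term is needed.
\<close>

lemma linear_recursion_unroll:
  fixes x p :: "nat \<Rightarrow> 'n::finite \<Rightarrow> 'a::real_vector"
  assumes first: "\<And>i. x (Suc 0) i = (\<Sum>j\<in>UNIV. W 0 $ i $ j *\<^sub>R p 0 j)"
    and step: "\<And>t i. t < N \<Longrightarrow>
      x (Suc (Suc t)) i = (\<Sum>j\<in>UNIV. W (Suc t) $ i $ j *\<^sub>R (x (Suc t) j + p (Suc t) j))"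
    and "t \<le> N"
  shows "x (Suc t) i = (\<Sum>s\<le>t. \<Sum>j\<in>UNIV. backward_prod W s t $ i $ j *\<^sub>R p s j)"
  using \<open>t \<le> N\<close>
proof (induction t arbitrary: i)
  case 0
  then show ?case by (simp add: first backward_prod_same)
next
  case (Suc t)
  have "x (Suc (Suc t)) i = (\<Sum>k\<in>UNIV. W (Suc t) $ i $ k *\<^sub>R
      (\<Sum>s\<le>t. \<Sum>j\<in>UNIV. backward_prod W s t $ k $ j *\<^sub>R p s j)) +
      (\<Sum>j\<in>UNIV. W (Suc t) $ i $ j *\<^sub>R p (Suc t) j)"
    using Suc by (simp add: step scaleR_add_right sum.distrib)
  also have "(\<Sum>k\<in>UNIV. W (Suc t) $ i $ k *\<^sub>R
      (\<Sum>s\<le>t. \<Sum>j\<in>UNIV. backward_prod W s t $ k $ j *\<^sub>R p s j)) =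
      (\<Sum>s\<le>t. \<Sum>k\<in>UNIV. W (Suc t) $ i $ k *\<^sub>R
        (\<Sum>j\<in>UNIV. backward_prod W s t $ k $ j *\<^sub>R p s j))"
    unfolding scaleR_sum_right[of _ _ "{..t}"] by (rule sum.swap)
  also have "\<dots> = (\<Sum>s\<le>t. \<Sum>j\<in>UNIV. backward_prod W s (Suc t) $ i $ j *\<^sub>R p s j)"
    by (rule sum.cong) (simp_all add: backward_prod_Suc sum_matrix_mult_scaleR)
  finally show ?case by (simp add: backward_prod_same)
qed

lemma avg_vec_scaleR_column_sum:
  fixes A :: "real^'n^'n" and u :: "'n \<Rightarrow> 'a::real_vector"
  assumes "\<And>j. (\<Sum>i\<in>UNIV. A $ i $ j) = 1"
  shows "avg_vec (\<lambda>i. \<Sum>j\<in>UNIV. A $ i $ j *\<^sub>R u j) = avg_vec u"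
proof -
  have "(\<Sum>i\<in>UNIV. \<Sum>j\<in>UNIV. A $ i $ j *\<^sub>R u j) = (\<Sum>j\<in>UNIV. \<Sum>i\<in>UNIV. A $ i $ j *\<^sub>R u j)"
    by (rule sum.swap)
  also have "\<dots> = (\<Sum>j\<in>UNIV. u j)"
    by (simp add: scaleR_sum_left[symmetric] assms)
  finally show ?thesis by (simp add: avg_vec_def)
qed

lemma avg_vec_sum: "avg_vec (\<lambda>i. \<Sum>s\<in>S. u s i) = (\<Sum>s\<in>S. avg_vec (u s))"
  unfolding avg_vec_def scaleR_sum_right[symmetric] by (subst sum.swap) (rule refl)

lemma avg_vec_diff_scaleR:
  "avg_vec (\<lambda>i. u i - c *\<^sub>R v i) = avg_vec u - c *\<^sub>R avg_vec v"
  by (simp add: avg_vec_def sum_subtractf scaleR_sum_right[symmetric] scaleR_diff_right)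

lemma push_y_unroll:
  assumes "push_weights E \<beta> W"
  shows "push_y E W (Suc t) i = (\<Sum>j\<in>UNIV. backward_prod W 0 t $ i $ j)"
proof (induction t arbitrary: i)
  case 0
  show ?case
    using push_weights_sum_in_nbrs[OF assms, of 0 i "\<lambda>_. 1::real"]
    by (simp add: backward_prod_same)
next
  case (Suc t)
  have "push_y E W (Suc (Suc t)) i =
      (\<Sum>k\<in>UNIV. W (Suc t) $ i $ k * (\<Sum>j\<in>UNIV. backward_prod W 0 t $ k $ j))"
    using push_weights_sum_in_nbrs[OF assms, of "Suc t" i "push_y E W (Suc t)"] Suc.IH
    by simp
  then show ?case
    using sum_matrix_mult_scaleR[of "W (Suc t)" "backward_prod W 0 t" i "\<lambda>_. 1::real"]
    by (simp add: backward_prod_Suc)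
qed

section \<open>Deviation of the ratios from the network average\<close>

text \<open>
  The limit vector \<open>v t\<close> of the mixing estimate is eliminated: \<open>y\<^sub>i (t + 1) / n\<close> is the mean of row
  \<open>i\<close> of \<open>W t ** \<dots> ** W 0\<close>, hence itself within \<open>4 \<mu>\<^sup>t\<close> of \<open>v\<^sub>i t\<close>, and the triangle inequality
  turns the constant \<open>4\<close> into \<open>8\<close>.
\<close>

lemma backward_prod_near_push_y:
  fixes W :: "nat \<Rightarrow> real^'n::finite^'n"
  assumes "push_weights E \<beta> W" "mixing_rate W \<mu>" "0 \<le> \<mu>" "\<mu> < 1" "s \<le> t"
  shows "\<bar>backward_prod W s t $ i $ j - push_y E W (Suc t) i / real CARD('n)\<bar> \<le> 8 * \<mu> ^ (t - s)"
proof -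
  obtain v where v: "\<And>t \<tau> i j. \<tau> \<le> t \<Longrightarrow>
      \<bar>backward_prod W \<tau> t $ i $ j - v t $ i\<bar> \<le> 4 * \<mu> ^ (t - \<tau>)"
    using assms(2) unfolding mixing_rate_def by blast
  have "\<bar>push_y E W (Suc t) i - real CARD('n) * v t $ i\<bar> =
      \<bar>\<Sum>j\<in>UNIV. backward_prod W 0 t $ i $ j - v t $ i\<bar>"
    by (simp add: push_y_unroll[OF assms(1)] sum_subtractf del: push_y.simps)
  also have "\<dots> \<le> (\<Sum>j\<in>(UNIV::'n set). 4 * \<mu> ^ t)"
    by (rule order_trans[OF sum_abs sum_mono]) (use v[of 0 t] in simp)
  also have "\<dots> \<le> real CARD('n) * (4 * \<mu> ^ (t - s))"
    using assms(3,4) by (simp add: power_decreasing)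
  finally have "\<bar>push_y E W (Suc t) i / real CARD('n) - v t $ i\<bar> \<le> 4 * \<mu> ^ (t - s)"
    by (simp add: abs_le_iff field_simps del: push_y.simps)
  with v[OF assms(5), of i j] show ?thesis by linarith
qed

text \<open>
  Column stochasticity makes the average of the states equal to the average of all inputs so far.
  Hence in \<open>x\<^sub>i - y\<^sub>i \<cdot> avg x\<close> each input is multiplied by exactly the matrix entry minus
  \<open>y\<^sub>i / n\<close>, which the previous estimate controls.
\<close>

lemma linear_recursion_deviation:
  fixes x p :: "nat \<Rightarrow> 'n::finite \<Rightarrow> 'a::real_normed_vector"
  assumes W: "push_weights E \<beta> W" "mixing_rate W \<mu>" "0 \<le> \<mu>" "\<mu> < 1"
    and first: "\<And>i. x (Suc 0) i = (\<Sum>j\<in>UNIV. W 0 $ i $ j *\<^sub>R p 0 j)"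
    and step: "\<And>t i. t < N \<Longrightarrow>
      x (Suc (Suc t)) i = (\<Sum>j\<in>UNIV. W (Suc t) $ i $ j *\<^sub>R (x (Suc t) j + p (Suc t) j))"
    and "t \<le> N"
  shows "norm (x (Suc t) i - push_y E W (Suc t) i *\<^sub>R avg_vec (x (Suc t))) \<le>
    8 * (\<Sum>s\<le>t. \<mu> ^ (t - s) * (\<Sum>j\<in>UNIV. norm (p s j)))"
proof -
  let ?y = "push_y E W (Suc t) i"
  let ?P = "\<lambda>s. backward_prod W s t"
  have x: "x (Suc t) = (\<lambda>i. \<Sum>s\<le>t. \<Sum>j\<in>UNIV. ?P s $ i $ j *\<^sub>R p s j)"
    by (rule ext, rule linear_recursion_unroll[where N = N]) (use first step \<open>t \<le> N\<close> in auto)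
  have "avg_vec (x (Suc t)) = (\<Sum>s\<le>t. avg_vec (p s))"
    unfolding x by (subst avg_vec_sum, intro sum.cong refl avg_vec_scaleR_column_sum
        backward_prod_column_sum push_weights_column_sum[OF W(1)]) simp
  then have "?y *\<^sub>R avg_vec (x (Suc t)) =
      (\<Sum>s\<le>t. \<Sum>j\<in>UNIV. (?y / real CARD('n)) *\<^sub>R p s j)"
    by (simp add: avg_vec_def scaleR_sum_right divide_inverse del: push_y.simps)
  then have "x (Suc t) i - ?y *\<^sub>R avg_vec (x (Suc t)) =
      (\<Sum>s\<le>t. \<Sum>j\<in>UNIV. (?P s $ i $ j - ?y / real CARD('n)) *\<^sub>R p s j)"
    by (simp add: x sum_subtractf scaleR_diff_left del: push_y.simps)
  also have "norm \<dots> \<le> (\<Sum>s\<le>t. \<Sum>j\<in>UNIV. 8 * \<mu> ^ (t - s) * norm (p s j))"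
    by (intro sum_norm_le)
      (auto intro!: mult_right_mono backward_prod_near_push_y[OF W] simp del: push_y.simps)
  finally show ?thesis by (simp add: sum_distrib_left mult.assoc)
qed

text \<open>
  Dividing by \<open>y\<^sub>i \<ge> \<eta>\<close> turns the deviation of the states into one of the ratios. The inputs of
  the algorithm are the steps \<open>- \<alpha> s *\<^sub>R g s\<close>, with the initial state added at time \<open>0\<close>.
\<close>

lemma subgradient_push_deviation:
  fixes x z g :: "nat \<Rightarrow> 'n::finite \<Rightarrow> 'a::real_inner"
  assumes W: "push_weights E \<beta> W" "mixing_rate W \<mu>" "0 \<le> \<mu>" "\<mu> < 1"
    and y: "\<eta> > 0" "\<And>t i. \<eta> \<le> push_y E W t i"
    and run: "subgradient_push E W f \<alpha> H x z g" "{..t} \<subseteq> H"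
    and g: "\<And>s i. s \<in> H \<Longrightarrow> norm (g s i) \<le> G"
    and \<alpha>: "\<And>s. 0 \<le> \<alpha> s"
  shows "norm (avg_vec (x (Suc t)) - z (Suc t) i) \<le>
    8 / \<eta> * (\<mu> ^ t * (\<Sum>j\<in>UNIV. norm (x 0 j - \<alpha> 0 *\<^sub>R g 0 j)) +
      real CARD('n) * G * (\<Sum>s\<in>{1..t}. \<mu> ^ (t - s) * \<alpha> s))" (is "_ \<le> 8 / \<eta> * ?B")
proof -
  define p where "p = (\<lambda>s j. (if s = 0 then x 0 j else 0) - \<alpha> s *\<^sub>R g s j)"
  let ?y = "push_y E W (Suc t) i"
  have rec: "x (Suc s) i = (\<Sum>j\<in>UNIV. W s $ i $ j *\<^sub>R (x s j - \<alpha> s *\<^sub>R g s j))" if "s \<le> t" for s i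
    using run that unfolding subgradient_push_def
    by (subst push_weights_sum_in_nbrs[OF W(1), symmetric]) auto
  have "norm (x (Suc t) i - ?y *\<^sub>R avg_vec (x (Suc t))) \<le>
      8 * (\<Sum>s\<le>t. \<mu> ^ (t - s) * (\<Sum>j\<in>UNIV. norm (p s j)))"
    by (rule linear_recursion_deviation[OF W, where N = t]) (simp_all add: rec p_def)
  also have "(\<Sum>s\<le>t. \<mu> ^ (t - s) * (\<Sum>j\<in>UNIV. norm (p s j))) =
      \<mu> ^ t * (\<Sum>j\<in>UNIV. norm (p 0 j)) + (\<Sum>s\<in>{1..t}. \<mu> ^ (t - s) * (\<Sum>j\<in>UNIV. norm (p s j)))"
    by (simp add: atMost_atLeast0 sum.atLeast_Suc_atMost)
  also have "\<dots> \<le> \<mu> ^ t * (\<Sum>j\<in>UNIV. norm (p 0 j)) +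
      (\<Sum>s\<in>{1..t}. \<mu> ^ (t - s) * (real CARD('n) * (\<alpha> s * G)))"
  proof (intro add_left_mono sum_mono mult_left_mono)
    fix s assume s: "s \<in> {1..t}"
    have "norm (p s j) \<le> \<alpha> s * G" for j
      using s run(2) g[of s j] \<alpha>[of s] by (auto simp: p_def intro!: mult_left_mono)
    then show "(\<Sum>j\<in>UNIV. norm (p s j)) \<le> real CARD('n) * (\<alpha> s * G)"
      using sum_bounded_above[of UNIV "\<lambda>j. norm (p s j)" "\<alpha> s * G"] by simp
  qed (use W(3) in simp)
  also have "\<dots> = ?B"
    by (simp add: p_def sum_distrib_left mult_ac)
  finally have dev: "norm (x (Suc t) i - ?y *\<^sub>R avg_vec (x (Suc t))) \<le> 8 * ?B"
    by simp
  have y0: "?y > 0" and ye: "?y \<ge> \<eta>" using y by (metis less_le_trans)+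
  have "avg_vec (x (Suc t)) - z (Suc t) i =
      - ((x (Suc t) i - ?y *\<^sub>R avg_vec (x (Suc t))) /\<^sub>R ?y)"
    using run(1) y0 unfolding subgradient_push_def
    by (simp add: scaleR_diff_right del: push_y.simps)
  then have "norm (avg_vec (x (Suc t)) - z (Suc t) i) =
      norm (x (Suc t) i - ?y *\<^sub>R avg_vec (x (Suc t))) / ?y"
    using y0 by (simp add: divide_inverse mult.commute del: push_y.simps)
  also have "\<dots> \<le> 8 * ?B / \<eta>"
    by (rule frac_le) (use dev ye y(1) order_trans[OF norm_ge_zero dev] in auto)
  finally show ?thesis by simp
qed

section \<open>Descent of the network average\<close>

text \<open>
  The inequality comes from expanding \<open>\<parallel>c - \<alpha> *\<^sub>R avg_vec g - zs\<parallel>\<^sup>2\<close>. The subgradient \<open>g i\<close> is taken at \<open>u i\<close>,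
  neither at \<open>c\<close> nor at the point \<open>w\<close> of interest: replacing \<open>c\<close> by \<open>u i\<close> in its inequality costs
  \<open>G \<parallel>c - u i\<parallel>\<close>, and replacing \<open>f i (u i)\<close> by \<open>f i w\<close> costs \<open>G \<parallel>w - u i\<parallel>\<close> by a bounded
  subgradient of \<open>f i\<close> at \<open>w\<close>.
\<close>

lemma averaged_subgradient_step:
  fixes c w zs :: "'a::real_inner" and u g :: "'n::finite \<Rightarrow> 'a"
  assumes sub: "\<And>i. is_subgradient (f i) (u i) (g i)" "\<And>i. norm (g i) \<le> G"
    and at_w: "\<And>i. \<exists>s. is_subgradient (f i) w s \<and> norm s \<le> G"
    and "0 \<le> \<alpha>"
  shows "2 * \<alpha> * (avg_fun f w - avg_fun f zs) \<le>
    (norm (c - zs))\<^sup>2 - (norm (c - \<alpha> *\<^sub>R avg_vec g - zs))\<^sup>2 + G\<^sup>2 * \<alpha>\<^sup>2 +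
    2 * G / real CARD('n) * (\<alpha> * (\<Sum>i\<in>UNIV. norm (c - u i) + norm (w - u i)))"
proof -
  let ?n = "real CARD('n)" and ?D = "\<Sum>i\<in>UNIV. norm (c - u i) + norm (w - u i)"
  have cs: "\<bar>h \<bullet> d\<bar> \<le> G * norm d" if "norm h \<le> G" for h d :: 'a
    by (rule order_trans[OF Cauchy_Schwarz_ineq2 mult_right_mono[OF that]]) simp
  have pt: "f i w - f i zs - G * (norm (c - u i) + norm (w - u i)) \<le> (c - zs) \<bullet> g i" for i
  proof -
    obtain s where s: "is_subgradient (f i) w s" "norm s \<le> G" using at_w by blast
    have "f i w + s \<bullet> (u i - w) \<le> f i (u i)" "f i (u i) + g i \<bullet> (zs - u i) \<le> f i zs"
      using s(1) sub(1) by (auto simp: is_subgradient_def)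
    moreover have "\<bar>s \<bullet> (u i - w)\<bar> \<le> G * norm (w - u i)"
      using cs[OF s(2), of "u i - w"] by (simp add: norm_minus_commute)
    moreover have "\<bar>g i \<bullet> (c - u i)\<bar> \<le> G * norm (c - u i)"
      by (rule cs[OF sub(2)])
    moreover have "(c - zs) \<bullet> g i = g i \<bullet> (c - u i) - g i \<bullet> (zs - u i)"
      by (simp add: inner_diff_right inner_commute)
    ultimately show ?thesis unfolding distrib_left by linarith
  qed
  have "(\<Sum>i\<in>UNIV. f i w - f i zs - G * (norm (c - u i) + norm (w - u i))) \<le>
      (\<Sum>i\<in>UNIV. (c - zs) \<bullet> g i)"
    by (rule sum_mono) (rule pt)
  then have "(\<Sum>i\<in>UNIV. f i w) - (\<Sum>i\<in>UNIV. f i zs) - G * ?D \<le> (c - zs) \<bullet> (\<Sum>i\<in>UNIV. g i)"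
    by (simp add: sum_subtractf sum_distrib_left inner_sum_right)
  then have "((\<Sum>i\<in>UNIV. f i w) - (\<Sum>i\<in>UNIV. f i zs) - G * ?D) / ?n \<le>
      (c - zs) \<bullet> (\<Sum>i\<in>UNIV. g i) / ?n"
    by (rule divide_right_mono) simp
  then have "avg_fun f w - avg_fun f zs - G * ?D / ?n \<le> (c - zs) \<bullet> avg_vec g"
    by (simp add: avg_fun_def avg_vec_def diff_divide_distrib inverse_eq_divide)
  from mult_left_mono[OF this, of "2 * \<alpha>"] \<open>0 \<le> \<alpha>\<close>
  have lin: "2 * \<alpha> * (avg_fun f w - avg_fun f zs) \<le>
      2 * \<alpha> * ((c - zs) \<bullet> avg_vec g) + 2 * G / ?n * (\<alpha> * ?D)"
    by (simp add: algebra_simps)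
  have "norm (\<Sum>i\<in>UNIV. g i) \<le> ?n * G"
    using sum_norm_bound[of UNIV g G] sub(2) by simp
  then have "norm (avg_vec g) \<le> G"
    by (simp add: avg_vec_def field_simps)
  then have "\<alpha>\<^sup>2 * (norm (avg_vec g))\<^sup>2 \<le> G\<^sup>2 * \<alpha>\<^sup>2"
    by (subst mult.commute, intro mult_right_mono power_mono) auto
  moreover have "(norm (c - \<alpha> *\<^sub>R avg_vec g - zs))\<^sup>2 =
      (norm (c - zs))\<^sup>2 - 2 * \<alpha> * ((c - zs) \<bullet> avg_vec g) + \<alpha>\<^sup>2 * (norm (avg_vec g))\<^sup>2"
  proof -
    have "(norm (d - \<alpha> *\<^sub>R h))\<^sup>2 = (norm d)\<^sup>2 - 2 * \<alpha> * (d \<bullet> h) + \<alpha>\<^sup>2 * (norm h)\<^sup>2" for d h :: 'a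
      unfolding power2_norm_eq_inner
      by (simp add: inner_diff_left inner_diff_right inner_commute power2_eq_square algebra_simps)
    from this[of "c - zs" "avg_vec g"] show ?thesis by (simp add: diff_diff_eq add.commute)
  qed
  ultimately show ?thesis using lin by linarith
qed

lemma avg_fun_convex:
  fixes f :: "'n::finite \<Rightarrow> 'a::real_vector \<Rightarrow> real"
  assumes "\<And>i. convex_on UNIV (f i)"
  shows "convex_on UNIV (avg_fun f)"
proof -
  have "convex_on UNIV (\<lambda>z. \<Sum>i\<in>A. f i z)" if "finite A" for A
    using that
  proof induction
    case empty
    show ?case by (simp add: convex_on_def)
  next
    case (insert i A)
    then show ?case by (simp add: convex_on_add assms)
  qed
  then have "convex_on UNIV (\<lambda>z. (1 / real CARD('n)) * (\<Sum>i\<in>UNIV. f i z))"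
    by (intro convex_on_cmul) auto
  then show ?thesis by (simp add: avg_fun_def[abs_def] field_simps)
qed

text \<open>
  Telescoping the descent inequality leaves a weighted sum of deviations. The summand of time \<open>0\<close> is
  kept, and there \<open>x = z\<close> because \<open>y = 1\<close>; hence the sum over the later times is indexed by
  \<open>\<tau> < N\<close> with weights \<open>\<alpha> (Suc \<tau>)\<close>. Only the run up to time \<open>N\<close> enters, so the estimate
  serves infinite and finite runs alike.
\<close>

lemma subgradient_push_weighted_gap:
  fixes x z g :: "nat \<Rightarrow> 'n::finite \<Rightarrow> 'a::real_inner"
  assumes W: "push_weights E \<beta> W" "mixing_rate W \<mu>" "0 \<le> \<mu>" "\<mu> < 1"
    and y: "\<eta> > 0" "\<And>t i. \<eta> \<le> push_y E W t i"
    and conv: "\<And>i. convex_on UNIV (f i)"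
    and "0 \<le> G"
    and run: "subgradient_push E W f \<alpha> H x z g" "{..N} \<subseteq> H"
    and g: "subgradients_bounded f H z g G"
    and \<alpha>: "\<And>s. 0 < \<alpha> s"
  shows "avg_fun f ((\<Sum>\<tau>\<le>N. \<alpha> \<tau> *\<^sub>R z \<tau> k) /\<^sub>R (\<Sum>\<tau>\<le>N. \<alpha> \<tau>)) - avg_fun f zs \<le>
    ((norm (avg_vec (z 0) - zs))\<^sup>2 + G\<^sup>2 * (\<Sum>\<tau>\<le>N. (\<alpha> \<tau>)\<^sup>2)) / (\<Sum>\<tau>\<le>N. 2 * \<alpha> \<tau>)
    + G * \<alpha> 0 * (\<Sum>i\<in>UNIV. norm (avg_vec (z 0) - z 0 i) + norm (z 0 k - z 0 i))
        / (real CARD('n) * (\<Sum>\<tau>\<le>N. \<alpha> \<tau>))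
    + 24 * G / \<eta> * (\<Sum>\<tau><N. \<alpha> (Suc \<tau>) *
        (\<mu> ^ \<tau> * (\<Sum>j\<in>UNIV. norm (x 0 j - \<alpha> 0 *\<^sub>R g 0 j)) +
         real CARD('n) * G * (\<Sum>s\<in>{1..\<tau>}. \<mu> ^ (\<tau> - s) * \<alpha> s))) / (\<Sum>\<tau>\<le>N. \<alpha> \<tau>)"
    (is "_ \<le> (?R0 + G\<^sup>2 * ?Q) / _ + _ + 24 * G / \<eta> * ?M / _")
proof -
  let ?n = "real CARD('n)" and ?A = "\<Sum>\<tau>\<le>N. \<alpha> \<tau>"
  let ?B = "\<lambda>\<tau>. \<mu> ^ \<tau> * (\<Sum>j\<in>UNIV. norm (x 0 j - \<alpha> 0 *\<^sub>R g 0 j)) +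
         ?n * G * (\<Sum>s\<in>{1..\<tau>}. \<mu> ^ (\<tau> - s) * \<alpha> s)"
  define D where "D = (\<lambda>\<tau>. \<Sum>i\<in>UNIV. norm (avg_vec (x \<tau>) - z \<tau> i) + norm (z \<tau> k - z \<tau> i))"
  let ?r = "\<lambda>\<tau>. (norm (avg_vec (x \<tau>) - zs))\<^sup>2"
  have A: "?A > 0" by (rule sum_pos) (use \<alpha> in auto)
  have z0: "z 0 = x 0" using run(1) by (auto simp: subgradient_push_def)
  have avg: "avg_vec (x (Suc \<tau>)) = avg_vec (x \<tau>) - \<alpha> \<tau> *\<^sub>R avg_vec (g \<tau>)" if "\<tau> \<le> N" for \<tau>
  proof -
    have "x (Suc \<tau>) = (\<lambda>i. \<Sum>j\<in>UNIV. W \<tau> $ i $ j *\<^sub>R (x \<tau> j - \<alpha> \<tau> *\<^sub>R g \<tau> j))"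
      using run that unfolding subgradient_push_def
      by (subst push_weights_sum_in_nbrs[OF W(1), symmetric]) (simp add: fun_eq_iff subset_iff)
    then show ?thesis
      using avg_vec_scaleR_column_sum[OF push_weights_column_sum[OF W(1)],
          of \<tau> "\<lambda>j. x \<tau> j - \<alpha> \<tau> *\<^sub>R g \<tau> j"]
      by (simp add: avg_vec_diff_scaleR)
  qed
  have step: "2 * \<alpha> \<tau> * (avg_fun f (z \<tau> k) - avg_fun f zs) \<le>
      ?r \<tau> - ?r (Suc \<tau>) + G\<^sup>2 * (\<alpha> \<tau>)\<^sup>2 + 2 * G / ?n * (\<alpha> \<tau> * D \<tau>)" if "\<tau> \<le> N" for \<tau>
    unfolding avg[OF that] D_def
    by (rule averaged_subgradient_step)
      (use run g that \<alpha>[of \<tau>] in \<open>auto simp: subgradient_push_def subgradients_bounded_def\<close>)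
  have "(\<Sum>\<tau>\<le>N. 2 * \<alpha> \<tau> * (avg_fun f (z \<tau> k) - avg_fun f zs)) \<le>
      (\<Sum>\<tau>\<le>N. ?r \<tau> - ?r (Suc \<tau>) + G\<^sup>2 * (\<alpha> \<tau>)\<^sup>2 + 2 * G / ?n * (\<alpha> \<tau> * D \<tau>))"
    by (rule sum_mono) (use step in auto)
  also have "\<dots> = ?r 0 - ?r (Suc N) + G\<^sup>2 * ?Q + 2 * G / ?n * (\<Sum>\<tau>\<le>N. \<alpha> \<tau> * D \<tau>)"
    using sum_telescope[of ?r N] by (simp add: sum.distrib sum_distrib_left)
  also have "\<dots> \<le> ?R0 + G\<^sup>2 * ?Q + 2 * G / ?n * (\<Sum>\<tau>\<le>N. \<alpha> \<tau> * D \<tau>)"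
    by (simp add: z0)
  finally have sum_gap: "(\<Sum>\<tau>\<le>N. 2 * \<alpha> \<tau> * (avg_fun f (z \<tau> k) - avg_fun f zs)) \<le>
      ?R0 + G\<^sup>2 * ?Q + 2 * G / ?n * (\<Sum>\<tau>\<le>N. \<alpha> \<tau> * D \<tau>)" .
  have D: "D (Suc \<tau>) \<le> ?n * (24 / \<eta> * ?B \<tau>)" if "\<tau> < N" for \<tau>
  proof -
    have dev: "norm (avg_vec (x (Suc \<tau>)) - z (Suc \<tau>) i) \<le> 8 / \<eta> * ?B \<tau>" for i
      by (rule subgradient_push_deviation[OF W y run(1)])
        (use run(2) that g \<alpha> in \<open>auto simp: subgradients_bounded_def less_imp_le\<close>)
    have pair: "norm (avg_vec (x (Suc \<tau>)) - z (Suc \<tau>) i) + norm (z (Suc \<tau>) k - z (Suc \<tau>) i)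
        \<le> 24 / \<eta> * ?B \<tau>" for i
    proof -
      have "norm (z (Suc \<tau>) k - z (Suc \<tau>) i) \<le>
          norm (avg_vec (x (Suc \<tau>)) - z (Suc \<tau>) k) + norm (avg_vec (x (Suc \<tau>)) - z (Suc \<tau>) i)"
        by norm
      then have "norm (z (Suc \<tau>) k - z (Suc \<tau>) i) \<le> 8 / \<eta> * ?B \<tau> + 8 / \<eta> * ?B \<tau>"
        by (rule order_trans[OF _ add_mono[OF dev dev]])
      from add_mono[OF dev[of i] this]
      have "norm (avg_vec (x (Suc \<tau>)) - z (Suc \<tau>) i) + norm (z (Suc \<tau>) k - z (Suc \<tau>) i)
          \<le> 8 / \<eta> * ?B \<tau> + (8 / \<eta> * ?B \<tau> + 8 / \<eta> * ?B \<tau>)" .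
      moreover have "8 / \<eta> * B + (8 / \<eta> * B + 8 / \<eta> * B) = 24 / \<eta> * B" for B
        by simp
      ultimately show ?thesis by (simp only:)
    qed
    have "(\<Sum>i\<in>UNIV. h i) \<le> ?n * K" if "\<And>i. h i \<le> K" for h :: "'n \<Rightarrow> real" and K
      using sum_bounded_above[of UNIV h K] that by simp
    then show ?thesis unfolding D_def using pair .
  qed
  have "(\<Sum>\<tau>\<le>N. \<alpha> \<tau> * D \<tau>) = \<alpha> 0 * D 0 + (\<Sum>\<tau><N. \<alpha> (Suc \<tau>) * D (Suc \<tau>))"
    by (simp add: sum.atMost_shift)
  also have "\<dots> \<le> \<alpha> 0 * D 0 + (\<Sum>\<tau><N. \<alpha> (Suc \<tau>) * (?n * (24 / \<eta> * ?B \<tau>)))"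
    by (intro add_left_mono sum_mono mult_left_mono) (use D \<alpha> in \<open>auto simp: less_imp_le\<close>)
  also have "(\<Sum>\<tau><N. \<alpha> (Suc \<tau>) * (?n * (24 / \<eta> * ?B \<tau>))) = ?n * (24 / \<eta> * ?M)"
    unfolding sum_distrib_left by (intro sum.cong refl) (simp only: mult_ac)
  finally have "2 * G / ?n * (\<Sum>\<tau>\<le>N. \<alpha> \<tau> * D \<tau>) \<le>
      2 * G / ?n * (\<alpha> 0 * D 0 + ?n * (24 / \<eta> * ?M))"
    by (rule mult_left_mono) (use \<open>0 \<le> G\<close> in simp)
  also have "\<dots> = 2 * (G * \<alpha> 0 * D 0 / ?n + 24 * G / \<eta> * ?M)"
    by (simp add: distrib_left)
  finally have total: "(\<Sum>\<tau>\<le>N. 2 * \<alpha> \<tau> * (avg_fun f (z \<tau> k) - avg_fun f zs)) \<le>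
      ?R0 + G\<^sup>2 * ?Q + 2 * (G * \<alpha> 0 * D 0 / ?n + 24 * G / \<eta> * ?M)"
    using sum_gap by linarith
  have "avg_fun f (\<Sum>\<tau>\<le>N. (\<alpha> \<tau> / ?A) *\<^sub>R z \<tau> k) \<le> (\<Sum>\<tau>\<le>N. (\<alpha> \<tau> / ?A) * avg_fun f (z \<tau> k))"
    by (rule convex_on_sum[OF _ _ avg_fun_convex[OF conv]])
      (use A \<alpha> in \<open>auto simp: sum_divide_distrib[symmetric] less_imp_le\<close>)
  moreover have "(\<Sum>\<tau>\<le>N. (\<alpha> \<tau> / ?A) *\<^sub>R z \<tau> k) = (\<Sum>\<tau>\<le>N. \<alpha> \<tau> *\<^sub>R z \<tau> k) /\<^sub>R ?A"
    by (simp add: scaleR_sum_right divide_inverse mult.commute)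
  moreover have "(\<Sum>\<tau>\<le>N. (\<alpha> \<tau> / ?A) * avg_fun f (z \<tau> k)) - avg_fun f zs =
      (\<Sum>\<tau>\<le>N. 2 * \<alpha> \<tau> * (avg_fun f (z \<tau> k) - avg_fun f zs)) / (2 * ?A)"
  proof -
    have "(\<Sum>\<tau>\<le>N. 2 * \<alpha> \<tau> * (avg_fun f (z \<tau> k) - avg_fun f zs)) =
        2 * ((\<Sum>\<tau>\<le>N. \<alpha> \<tau> * avg_fun f (z \<tau> k)) - ?A * avg_fun f zs)"
      by (simp add: sum_distrib_left sum_distrib_right sum_subtractf algebra_simps)
    then show ?thesis
      using A by (simp add: sum_divide_distrib[symmetric] diff_divide_distrib)
  qed
  moreover have "(\<Sum>\<tau>\<le>N. 2 * \<alpha> \<tau> * (avg_fun f (z \<tau> k) - avg_fun f zs)) / (2 * ?A) \<le>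
      (?R0 + G\<^sup>2 * ?Q + 2 * (G * \<alpha> 0 * D 0 / ?n + 24 * G / \<eta> * ?M)) / (2 * ?A)"
    by (rule divide_right_mono[OF total]) (use A in simp)
  moreover have "(?R0 + G\<^sup>2 * ?Q + 2 * (G * \<alpha> 0 * D 0 / ?n + 24 * G / \<eta> * ?M)) / (2 * ?A) =
      (?R0 + G\<^sup>2 * ?Q) / (\<Sum>\<tau>\<le>N. 2 * \<alpha> \<tau>) + G * \<alpha> 0 * D 0 / (?n * ?A) + 24 * G / \<eta> * ?M / ?A"
    by (simp only: sum_distrib_left[symmetric] add_divide_distrib distrib_left
        mult_divide_mult_cancel_left_if divide_divide_eq_left add.assoc) simp
  ultimately show ?thesis unfolding D_def z0 by simp
qed

section \<open>Geometric convolution with the stepsizes\<close>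

lemma geometric_sum_le:
  fixes \<mu> :: real
  assumes "0 \<le> \<mu>" "\<mu> < 1"
  shows "(\<Sum>\<tau><N. \<mu> ^ \<tau>) \<le> 1 / (1 - \<mu>)"
  using assms by (simp add: sum_gp_strict divide_right_mono)

lemma geometric_sum_reflect_le:
  fixes \<mu> :: real
  assumes "0 \<le> \<mu>" "\<mu> < 1" "b \<le> Suc c"
  shows "(\<Sum>s\<in>{a..<b}. \<mu> ^ (c - s)) \<le> \<mu> ^ (Suc c - b) / (1 - \<mu>)"
proof -
  have "(\<Sum>s\<in>{a..<b}. \<mu> ^ (c - s)) = (\<Sum>s\<in>{a..<b}. \<mu> ^ (Suc c - b) * \<mu> ^ (b - Suc s))"
    using assms(3) by (intro sum.cong refl) (simp add: power_add[symmetric])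
  also have "\<dots> \<le> (\<Sum>s\<in>{0..<b}. \<mu> ^ (Suc c - b) * \<mu> ^ (b - Suc s))"
    by (rule sum_mono2) (use assms in auto)
  also have "\<dots> = \<mu> ^ (Suc c - b) * (\<Sum>s<b. \<mu> ^ s)"
    using sum.nat_diff_reindex[of "\<lambda>s. \<mu> ^ s" b]
    by (simp add: sum_distrib_left[symmetric] atLeast0LessThan)
  also have "\<dots> \<le> \<mu> ^ (Suc c - b) * (1 / (1 - \<mu>))"
    by (intro mult_left_mono geometric_sum_le) (use assms in auto)
  finally show ?thesis by simp
qed

text \<open>
  Split at the middle: terms with \<open>s < \<lceil>t/2\<rceil>\<close> are old enough to carry a factor
  \<open>\<mu>\<^bsup>t/2\<^esup>\<close>, and in the other ones \<open>\<alpha> s\<close> is at most \<open>\<alpha> \<lceil>t/2\<rceil>\<close> by monotonicity.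
\<close>

lemma geometric_convolution_le:
  fixes \<mu> :: real and \<alpha> :: "nat \<Rightarrow> real"
  assumes \<mu>: "0 \<le> \<mu>" "\<mu> < 1" and \<alpha>: "decseq \<alpha>" "\<And>t. 0 \<le> \<alpha> t"
  shows "(\<Sum>s\<in>{1..t}. \<mu> ^ (t - s) * \<alpha> s) \<le>
    (\<alpha> 0 * \<mu> powr (real t / 2) + \<alpha> (nat \<lceil>real t / 2\<rceil>)) / (1 - \<mu>)"
proof (cases "t = 0")
  case True
  then show ?thesis using \<mu> \<alpha>(2)[of 0] by simp
next
  case False
  define m where "m = nat \<lceil>real t / 2\<rceil>"
  have m: "1 \<le> m" "m \<le> t" "real t / 2 \<le> real (Suc t - m)"
    using False unfolding m_def by linarith+
  have low: "(\<Sum>s\<in>{1..<m}. \<mu> ^ (t - s) * \<alpha> s) \<le> \<mu> powr (real t / 2) / (1 - \<mu>) * \<alpha> 0"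
  proof -
    have "(\<Sum>s\<in>{1..<m}. \<mu> ^ (t - s) * \<alpha> s) \<le> (\<Sum>s\<in>{1..<m}. \<mu> ^ (t - s)) * \<alpha> 0"
      unfolding sum_distrib_right
      by (intro sum_mono mult_left_mono) (use \<mu> \<alpha>(1) in \<open>auto simp: decseq_def\<close>)
    also have "\<dots> \<le> \<mu> ^ (Suc t - m) / (1 - \<mu>) * \<alpha> 0"
      by (intro mult_right_mono geometric_sum_reflect_le) (use \<mu> m \<alpha>(2) in auto)
    \<comment> \<open>For \<open>\<mu> = 0\<close> both sides vanish, the left one because its exponent is positive.\<close>
    also have "\<mu> ^ (Suc t - m) \<le> \<mu> powr (real t / 2)"
    proof (cases "\<mu> = 0")
      case True
      then show ?thesis using m by (simp add: zero_power)
    next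
      case False
      then have "\<mu> ^ (Suc t - m) = \<mu> powr real (Suc t - m)"
        using \<mu> by (simp add: powr_realpow)
      also have "\<dots> \<le> \<mu> powr (real t / 2)"
        by (rule powr_mono') (use \<mu> m in auto)
      finally show ?thesis .
    qed
    finally show ?thesis using \<mu> \<alpha>(2) by (simp add: mult_right_mono divide_right_mono)
  qed
  have high: "(\<Sum>s\<in>{m..<Suc t}. \<mu> ^ (t - s) * \<alpha> s) \<le> 1 / (1 - \<mu>) * \<alpha> m"
  proof -
    have "(\<Sum>s\<in>{m..<Suc t}. \<mu> ^ (t - s) * \<alpha> s) \<le> (\<Sum>s\<in>{m..<Suc t}. \<mu> ^ (t - s)) * \<alpha> m"
      unfolding sum_distrib_right
      by (intro sum_mono mult_left_mono) (use \<mu> \<alpha>(1) in \<open>auto simp: decseq_def\<close>)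
    also have "(\<Sum>s\<in>{m..<Suc t}. \<mu> ^ (t - s)) \<le> 1 / (1 - \<mu>)"
      using geometric_sum_reflect_le[OF \<mu>, of "Suc t" t m] by simp
    finally show ?thesis using \<alpha>(2) by (simp add: mult_right_mono)
  qed
  have "(\<Sum>s\<in>{1..t}. \<mu> ^ (t - s) * \<alpha> s) =
      (\<Sum>s\<in>{1..<m}. \<mu> ^ (t - s) * \<alpha> s) + (\<Sum>s\<in>{m..<Suc t}. \<mu> ^ (t - s) * \<alpha> s)"
    using m by (subst sum.atLeastLessThan_concat) (auto simp: atLeastLessThanSuc_atLeastAtMost)
  with low high show ?thesis
    unfolding m_def[symmetric] by (simp add: add_divide_distrib mult.commute)
qed

section \<open>The convergence rates\<close>

theorem theorem3:
  fixes E :: "nat \<Rightarrow> ('n::finite \<times> 'n) set"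
    and W :: "nat \<Rightarrow> real^'n^'n"
    and f :: "'n \<Rightarrow> real^'d \<Rightarrow> real"
    and L :: nat
    and \<beta> \<eta> \<mu> G :: real
    and zs :: "real^'d"
  assumes "\<And>t i. (i, i) \<in> E t"
    and "\<beta> > 0" and "push_weights E \<beta> W"
    and "L > 0" and "uniformly_strongly_connected E L"
    and "\<And>i. convex_on UNIV (f i)"
    and "\<And>z. avg_fun f zs \<le> avg_fun f z"
    and "G > 0"
    and "\<eta> > 0"
    and "\<And>t i. \<eta> \<le> push_y E W t i" and "\<And>t i. push_y E W t i \<le> real CARD('n)"
    and "\<eta> \<ge> 1 / real CARD('n) ^ (CARD('n) * L)"
    and "0 \<le> \<mu>" and "\<mu> < 1" and "mixing_rate W \<mu>"
    and "\<mu> \<le> (1 - 1 / real CARD('n) ^ (CARD('n) * L)) powr (1 / real L)"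
  shows
    "(\<forall>\<alpha> x z g.
        (\<forall>t. \<alpha> t > 0) \<and> decseq \<alpha> \<and>
        filterlim (\<lambda>t. \<Sum>\<tau>\<le>t. \<alpha> \<tau>) at_top sequentially \<and> summable (\<lambda>t. (\<alpha> t)\<^sup>2) \<and>
        subgradient_push E W f \<alpha> UNIV x z g \<and> subgradients_bounded f UNIV z g G \<longrightarrow>
        (\<forall>t k.
           avg_fun f ((\<Sum>\<tau>\<le>t. \<alpha> \<tau> *\<^sub>R z \<tau> k) /\<^sub>R (\<Sum>\<tau>\<le>t. \<alpha> \<tau>)) - avg_fun f zs
           \<le> ((norm (avg_vec (z 0) - zs))\<^sup>2 + G\<^sup>2 * (\<Sum>\<tau>\<le>t. (\<alpha> \<tau>)\<^sup>2)) / (\<Sum>\<tau>\<le>t. 2 * \<alpha> \<tau>)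
             + G * \<alpha> 0 * (\<Sum>i\<in>UNIV. norm (avg_vec (z 0) - z 0 i) + norm (z 0 k - z 0 i))
                 / (real CARD('n) * (\<Sum>\<tau>\<le>t. \<alpha> \<tau>))
             + 32 * G / \<eta> * (\<Sum>i\<in>UNIV. norm (x 0 i - \<alpha> 0 *\<^sub>R g 0 i))
                 * ((\<Sum>\<tau><t. \<alpha> \<tau> * \<mu> ^ \<tau>) / (\<Sum>\<tau>\<le>t. \<alpha> \<tau>))
             + 32 * real CARD('n) * G\<^sup>2 / (\<eta> * (1 - \<mu>))
                 * ((\<Sum>\<tau><t. \<alpha> \<tau> * (\<alpha> 0 * \<mu> powr (real \<tau> / 2) + \<alpha> (nat \<lceil>real \<tau> / 2\<rceil>)))
                    / (\<Sum>\<tau>\<le>t. \<alpha> \<tau>))))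
     \<and>
     (\<forall>(T::nat) x z g.
        T > 0 \<and>
        subgradient_push E W f (\<lambda>t. 1 / sqrt (real T)) {..<T} x z g \<and>
        subgradients_bounded f {..<T} z g G \<longrightarrow>
        (\<forall>k.
           avg_fun f ((\<Sum>\<tau><T. z \<tau> k) /\<^sub>R real T) - avg_fun f zs
           \<le> ((norm (avg_vec (z 0) - zs))\<^sup>2 + G\<^sup>2) / (2 * sqrt (real T))
             + 32 * real CARD('n) * G\<^sup>2 / (\<eta> * (1 - \<mu>) * sqrt (real T))
             + G * (\<Sum>i\<in>UNIV. norm (avg_vec (z 0) - z 0 i) + norm (z 0 k - z 0 i))
                 / (real CARD('n) * real T)
             + 32 * G / (\<eta> * (1 - \<mu>) * real T)
                 * (\<Sum>i\<in>UNIV. norm (x 0 i - (1 / sqrt (real T)) *\<^sub>R g 0 i))))"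
proof (intro conjI allI impI, goal_cases)
  case (1 \<alpha> x z g t k)
  then have \<alpha>: "\<And>s. \<alpha> s > 0" "decseq \<alpha>"
    and run: "subgradient_push E W f \<alpha> UNIV x z g" "subgradients_bounded f UNIV z g G"
    by auto
  let ?n = "real CARD('n)" and ?A = "\<Sum>\<tau>\<le>t. \<alpha> \<tau>"
  let ?S = "\<Sum>i\<in>UNIV. norm (x 0 i - \<alpha> 0 *\<^sub>R g 0 i)"
  let ?c = "\<lambda>\<tau>. \<alpha> 0 * \<mu> powr (real \<tau> / 2) + \<alpha> (nat \<lceil>real \<tau> / 2\<rceil>)"
  let ?K = "\<lambda>\<tau>. \<mu> ^ \<tau> * ?S + ?n * G * (\<Sum>s\<in>{1..\<tau>}. \<mu> ^ (\<tau> - s) * \<alpha> s)"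
  have A: "?A > 0" by (rule sum_pos) (use \<alpha> in auto)
  have \<alpha>0: "\<And>s. 0 \<le> \<alpha> s" using \<alpha>(1) by (simp add: less_imp_le)
  have "24 * G / \<eta> * (\<Sum>\<tau><t. \<alpha> (Suc \<tau>) * ?K \<tau>) / ?A
      \<le> 32 * G / \<eta> * (\<Sum>\<tau><t. \<alpha> \<tau> * (\<mu> ^ \<tau> * ?S + ?n * G * (?c \<tau> / (1 - \<mu>)))) / ?A"
  proof (intro divide_right_mono mult_mono sum_mono add_left_mono mult_left_mono)
    show "\<alpha> (Suc \<tau>) \<le> \<alpha> \<tau>" for \<tau>
      using \<alpha>(2) by (simp add: decseq_Suc_iff)
    show "(\<Sum>s\<in>{1..\<tau>}. \<mu> ^ (\<tau> - s) * \<alpha> s) \<le> ?c \<tau> / (1 - \<mu>)" for \<tau>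
      by (rule geometric_convolution_le) (use assms \<alpha> \<alpha>0 in auto)
  qed (use assms A \<alpha>0 in \<open>auto intro!: sum_nonneg mult_nonneg_nonneg add_nonneg_nonneg\<close>)
  also have "(\<Sum>\<tau><t. \<alpha> \<tau> * (\<mu> ^ \<tau> * ?S + ?n * G * (?c \<tau> / (1 - \<mu>)))) =
      ?S * (\<Sum>\<tau><t. \<alpha> \<tau> * \<mu> ^ \<tau>) + ?n * G / (1 - \<mu>) * (\<Sum>\<tau><t. \<alpha> \<tau> * ?c \<tau>)"
  proof -
    have "(\<Sum>\<tau><t. \<alpha> \<tau> * (\<mu> ^ \<tau> * S + C * (c \<tau> / M))) =
        S * (\<Sum>\<tau><t. \<alpha> \<tau> * \<mu> ^ \<tau>) + C / M * (\<Sum>\<tau><t. \<alpha> \<tau> * c \<tau>)" for S C M :: real and c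
      by (simp add: sum_distrib_left sum.distrib[symmetric] distrib_left mult_ac)
    then show ?thesis .
  qed
  also have "32 * G / \<eta> * \<dots> / ?A = 32 * G / \<eta> * ?S * ((\<Sum>\<tau><t. \<alpha> \<tau> * \<mu> ^ \<tau>) / ?A) +
      32 * ?n * G\<^sup>2 / (\<eta> * (1 - \<mu>)) * ((\<Sum>\<tau><t. \<alpha> \<tau> * ?c \<tau>) / ?A)"
    by (simp add: distrib_left add_divide_distrib power2_eq_square mult_ac)
  finally show ?case
    using subgradient_push_weighted_gap[where f = f and k = k and zs = zs and N = t,
        OF assms(3,15,13,14,9,10,6) less_imp_le[OF assms(8)] run(1) _ run(2) \<alpha>(1)]
    by simp
next
  case (2 T x z g k)
  then have T: "T > 0"
    and run: "subgradient_push E W f (\<lambda>t. 1 / sqrt (real T)) {..<T} x z g"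
      "subgradients_bounded f {..<T} z g G"
    by auto
  \<comment> \<open>The averaged iterates are those at the times \<open>0, \<dots>, T - 1\<close>.\<close>
  define N where "N = T - 1"
  have N: "{..<T} = {..N}" "real T = real (Suc N)" using T by (auto simp: N_def)
  let ?n = "real CARD('n)" and ?a = "1 / sqrt (real T)"
  let ?S = "\<Sum>i\<in>UNIV. norm (x 0 i - ?a *\<^sub>R g 0 i)"
  have a: "?a > 0" "?a * ?a * real T = 1" "?a * real T = sqrt (real T)"
    using T by (auto simp: field_simps)
  have A: "(\<Sum>\<tau>\<le>N. ?a) = sqrt (real T)" "(\<Sum>\<tau>\<le>N. 2 * ?a) = 2 * sqrt (real T)"
    "(\<Sum>\<tau>\<le>N. ?a\<^sup>2) = 1"
    using a unfolding sum_distrib_left[symmetric]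
    by (simp_all add: N(2)[symmetric] mult.commute power2_eq_square del: of_nat_Suc)
  let ?K = "\<lambda>\<tau>. \<mu> ^ \<tau> * ?S + ?n * G * (\<Sum>s\<in>{1..\<tau>}. \<mu> ^ (\<tau> - s) * ?a)"
  have S: "?S \<ge> 0" by (rule sum_nonneg) simp
  have "(\<Sum>\<tau><N. ?a * ?K \<tau>) \<le> (\<Sum>\<tau><N. ?a * (\<mu> ^ \<tau> * ?S + ?n * G * (1 / (1 - \<mu>) * ?a)))"
  proof (intro sum_mono mult_left_mono add_left_mono)
    fix \<tau>
    show "(\<Sum>s\<in>{1..\<tau>}. \<mu> ^ (\<tau> - s) * ?a) \<le> 1 / (1 - \<mu>) * ?a"
      using geometric_sum_reflect_le[OF assms(13,14), of "Suc \<tau>" \<tau> 1] a(1)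
      unfolding sum_distrib_right[symmetric]
      by (intro mult_right_mono) (auto simp: atLeastLessThanSuc_atLeastAtMost)
  qed (use assms a in auto)
  also have "\<dots> = (\<Sum>\<tau><N. \<mu> ^ \<tau>) * (?a * ?S) + ?n * G / (1 - \<mu>) * (real N * (?a * ?a))"
  proof -
    have "(\<Sum>\<tau><N. b * (\<mu> ^ \<tau> * S + C * (1 / M * b))) =
        (\<Sum>\<tau><N. \<mu> ^ \<tau>) * (b * S) + C / M * (real N * (b * b))" for b S C M :: real
      by (simp add: sum_distrib_left sum_distrib_right sum.distrib distrib_left mult_ac)
    then show ?thesis .
  qed
  also have "\<dots> \<le> 1 / (1 - \<mu>) * (?a * ?S) + ?n * G / (1 - \<mu>) * 1"
  proof (intro add_mono mult_mono)
    show "(\<Sum>\<tau><N. \<mu> ^ \<tau>) \<le> 1 / (1 - \<mu>)" by (rule geometric_sum_le[OF assms(13,14)])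
    have "real N * (?a * ?a) \<le> real T * (?a * ?a)"
      by (rule mult_right_mono) (use N(2) in auto)
    then show "real N * (?a * ?a) \<le> 1" using a(2) by (simp add: mult.commute)
  qed (use assms a S in auto)
  finally have M: "(\<Sum>\<tau><N. ?a * ?K \<tau>) \<le> 1 / (1 - \<mu>) * (?a * ?S) + ?n * G / (1 - \<mu>) * 1" .
  have M0: "0 \<le> (\<Sum>\<tau><N. ?a * ?K \<tau>)"
    by (intro sum_nonneg mult_nonneg_nonneg add_nonneg_nonneg) (use assms in auto)
  have "24 * G / \<eta> * (\<Sum>\<tau><N. ?a * ?K \<tau>) / sqrt (real T) \<le>
      32 * G / \<eta> * (1 / (1 - \<mu>) * (?a * ?S) + ?n * G / (1 - \<mu>) * 1) / sqrt (real T)"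
    by (rule divide_right_mono[OF mult_mono[OF _ M _ M0]])
      (use assms in \<open>auto intro!: divide_right_mono\<close>)
  also have "\<dots> = 32 * ?n * G\<^sup>2 / (\<eta> * (1 - \<mu>) * sqrt (real T)) +
      32 * G / (\<eta> * (1 - \<mu>) * real T) * ?S"
  proof -
    have "32 * G / \<eta> * (1 / M * (1 / r * S) + C * G / M * 1) / r =
        32 * C * G\<^sup>2 / (\<eta> * M * r) + 32 * G / (\<eta> * M * (r * r)) * S" for C M S r :: real
      by (simp add: distrib_left add_divide_distrib power2_eq_square mult_ac)
    from this[of "1 - \<mu>" "sqrt (real T)" ?S ?n] show ?thesis by simp
  qed
  finally have last: "24 * G / \<eta> * (\<Sum>\<tau><N. ?a * ?K \<tau>) / sqrt (real T) \<le> \<dots>" .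
  have mid: "G * ?a * X / (?n * sqrt (real T)) = G * X / (?n * real T)" for X
    using real_sqrt_mult_self[of "real T"] by (simp add: mult_ac)
  have mean: "(\<Sum>\<tau>\<le>N. ?a *\<^sub>R z \<tau> k) /\<^sub>R sqrt (real T) = (\<Sum>\<tau><T. z \<tau> k) /\<^sub>R real T"
    using real_sqrt_mult_self[of "real T"]
    by (simp add: N(1) scaleR_sum_right[symmetric] divide_inverse
        flip: inverse_mult_distrib)
  show ?case
    using subgradient_push_weighted_gap[where f = f and k = k and zs = zs and N = N,
        OF assms(3,15,13,14,9,10,6) less_imp_le[OF assms(8)] run(1) _ run(2) a(1)] last N(1)
    unfolding A mid mean by simp
qed

end
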